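(* If $\mathcal{C}$ is a covariety and $S\in\mathcal{C}$, then $\mathcal{C}_{\mathrm{rank}}(S)\leq e(S)$.
   Context: Let $\mathbb{N}=\{0,1,2,\dots\}$. A numerical semigroup is a subset $S\subseteq\mathbb{N}$ that contains $0$, is closed under addition, and has finite complement $\mathbb{N}\setminus S$. Its multiplicity is $m(S)=\min(S\setminus\{0\})$. The embedding dimension $e(S)$ is the cardinality of the unique minimal system of generators of $S$ as a submonoid of $(\mathbb{N},+)$. A covariety is a nonempty family $\mathcal{C}$ of numerical semigroups such that: (1) $\mathcal{C}$ has a minimum $\Delta(\mathcal{C})=\min(\mathcal{C})$ with respect to set inclusion; (2) if $S,T\in\mathcal{C}$ then $S\cap T\in\mathcal{C}$; (3) if $S\in\mathcal{C}$ and $S\neq\Delta(\mathcal{C})$ then $S\setminus\{m(S)\}\in\mathcal{C}$. A $\mathcal{C}$-set is a subset of $M\setminus\Delta(\mathcal{C})$ for some maximal (with respect to inclusion) element $M$ of $\mathcal{C}$. For a $\mathcal{C}$-set $A$, $\mathcal{C}(A)$ is the intersection of all elements of $\mathcal{C}$ containing $A$ (it is the least element of $\mathcal{C}$ containing $A$). For $S\in\mathcal{C}$, the $\mathcal{C}$-rank of $S$ is $\mathcal{C}_{\mathrm{rank}}(S)=\min\{\sharp A\mid A\text{ is a }\mathcal{C}\text{-set and }\mathcal{C}(A)=S\}$, where $\sharp A$ denotes the cardinality of $A$. *)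

theory Defs
  imports Complex_Main
begin

definition submonoid_nat :: "nat set \<Rightarrow> bool" where
  "submonoid_nat S \<longleftrightarrow> 0 \<in> S \<and> (\<forall>x\<in>S. \<forall>y\<in>S. x + y \<in> S)"

definition numerical_semigroup :: "nat set \<Rightarrow> bool" where
  "numerical_semigroup S \<longleftrightarrow> submonoid_nat S \<and> finite (- S)"

definition multiplicity :: "nat set \<Rightarrow> nat" where
  "multiplicity S = (LEAST x. x \<in> S - {0})"

definition generates :: "nat set \<Rightarrow> nat set \<Rightarrow> bool" where
  "generates A S \<longleftrightarrow> submonoid_nat hull A = S"

definition minimal_generating_set :: "nat set \<Rightarrow> nat set \<Rightarrow> bool" where
  "minimal_generating_set A S \<longleftrightarrow> generates A S \<and> (\<forall>B. B \<subset> A \<longrightarrow> \<not> generates B S)"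

definition embedding_dim :: "nat set \<Rightarrow> nat" where
  "embedding_dim S = card (THE A. minimal_generating_set A S)"

(* Least with respect to set inclusion, the order on nat set; it is only
   meaningful when the family has a minimum, which covarieties require. *)
definition family_min :: "nat set set \<Rightarrow> nat set" where
  "family_min \<C> = (LEAST S. S \<in> \<C>)"

definition covariety :: "nat set set \<Rightarrow> bool" where
  "covariety \<C> \<longleftrightarrow>
     \<C> \<noteq> {} \<and>
     (\<forall>S\<in>\<C>. numerical_semigroup S) \<and>
     (\<exists>D\<in>\<C>. \<forall>S\<in>\<C>. D \<subseteq> S) \<and>
     (\<forall>S\<in>\<C>. \<forall>T\<in>\<C>. S \<inter> T \<in> \<C>) \<and>
     (\<forall>S\<in>\<C>. S \<noteq> family_min \<C> \<longrightarrow> S - {multiplicity S} \<in> \<C>)"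

definition maximal_in :: "nat set \<Rightarrow> nat set set \<Rightarrow> bool" where
  "maximal_in M \<C> \<longleftrightarrow> M \<in> \<C> \<and> (\<forall>T\<in>\<C>. M \<subseteq> T \<longrightarrow> T = M)"

definition cov_set :: "nat set set \<Rightarrow> nat set \<Rightarrow> bool" where
  "cov_set \<C> A \<longleftrightarrow> (\<exists>M. maximal_in M \<C> \<and> A \<subseteq> M - family_min \<C>)"

definition cov_closure :: "nat set set \<Rightarrow> nat set \<Rightarrow> nat set" where
  "cov_closure \<C> A = \<Inter>{T \<in> \<C>. A \<subseteq> T}"

(* For S in a covariety the predicate below is satisfiable (see
   cov_rank_attained), so LEAST is a genuine minimum. *)
definition cov_rank :: "nat set set \<Rightarrow> nat set \<Rightarrow> nat" where
  "cov_rank \<C> S = (LEAST n. \<exists>A. cov_set \<C> A \<and> cov_closure \<C> A = S \<and> card A = n)"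

lemma family_min_least:
  assumes "covariety \<C>"
  shows "family_min \<C> \<in> \<C>" and "\<And>S. S \<in> \<C> \<Longrightarrow> family_min \<C> \<subseteq> S"
proof -
  obtain D where D: "D \<in> \<C>" "\<forall>S\<in>\<C>. D \<subseteq> S"
    using assms unfolding covariety_def by blast
  have "family_min \<C> = D"
    unfolding family_min_def by (rule Least_equality) (use D in auto)
  then show "family_min \<C> \<in> \<C>" and "\<And>S. S \<in> \<C> \<Longrightarrow> family_min \<C> \<subseteq> S"
    using D by auto
qed

lemma finite_covariety:
  assumes "covariety \<C>"
  shows "finite \<C>"
proof -
  have "finite (- family_min \<C>)"
    using family_min_least(1)[OF assms] assms
    unfolding covariety_def numerical_semigroup_def by blast
  moreover have "uminus ` \<C> \<subseteq> Pow (- family_min \<C>)"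
    using family_min_least(2)[OF assms] by auto
  ultimately have "finite (uminus ` \<C>)"
    by (meson finite_Pow_iff finite_subset)
  then show ?thesis
    by (rule finite_imageD) (auto simp: inj_on_def)
qed

lemma finite_cov_set:
  assumes "covariety \<C>" and "cov_set \<C> A"
  shows "finite A"
proof -
  have "finite (- family_min \<C>)"
    using family_min_least(1)[OF assms(1)] assms(1)
    unfolding covariety_def numerical_semigroup_def by blast
  moreover have "A \<subseteq> - family_min \<C>"
    using assms(2) unfolding cov_set_def by blast
  ultimately show ?thesis
    by (rule rev_finite_subset)
qed

lemma cov_set_exists:
  assumes "covariety \<C>" and "S \<in> \<C>"
  shows "\<exists>A. cov_set \<C> A \<and> cov_closure \<C> A = S"
proof (intro exI conjI)
  obtain M where M: "M \<in> \<C>" "S \<subseteq> M" "\<forall>T\<in>\<C>. M \<subseteq> T \<longrightarrow> M = T"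
    using finite_has_maximal2[OF finite_covariety[OF assms(1)] assms(2)] by blast
  show "cov_set \<C> (S - family_min \<C>)"
    unfolding cov_set_def maximal_in_def using M by blast
  show "cov_closure \<C> (S - family_min \<C>) = S"
    unfolding cov_closure_def using family_min_least(2)[OF assms(1)] assms(2) by blast
qed

lemma cov_rank_attained:
  assumes "covariety \<C>" and "S \<in> \<C>"
  shows "\<exists>A. cov_set \<C> A \<and> cov_closure \<C> A = S \<and> card A = cov_rank \<C> S"
  unfolding cov_rank_def
  by (rule LeastI_ex) (use cov_set_exists[OF assms] in blast)

end

theory Submission
  imports Defs
begin

text \<open>
  Let \<open>G\<close> be the set of nonzero elements of \<open>S\<close> that are not sums of two nonzero elements
  of \<open>S\<close>; it is the minimal system of generators of \<open>S\<close>. Discarding from \<open>G\<close> the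
  elements of the minimum of the covariety leaves a covariety-set whose closure is \<open>S\<close>: every
  member containing it also contains the minimum, hence all of \<open>G\<close>, hence \<open>S\<close>.
\<close>

definition atoms :: "nat set \<Rightarrow> nat set" where
  "atoms S = {x \<in> S - {0}. \<forall>y\<in>S - {0}. \<forall>z\<in>S - {0}. x \<noteq> y + z}"

lemma submonoid_nat_mult:
  assumes "submonoid_nat S" and "m \<in> S"
  shows "k * m \<in> S"
  using assms by (induction k) (auto simp: submonoid_nat_def)

lemma submonoid_nat_hull: "submonoid_nat (submonoid_nat hull A)"
  by (rule hull_in) (auto simp: submonoid_nat_def)

lemma atoms_subset: "atoms S \<subseteq> S"
  by (auto simp: atoms_def)

text \<open>Strong induction: a nonzero element of \<open>S\<close> that is not an atom splits into
  two strictly smaller elements of \<open>S\<close>. It serves twice, with \<open>T\<close> the hull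
  of the atoms and with \<open>T\<close> a member of the covariety.\<close>

lemma subset_if_atoms_subset:
  assumes "submonoid_nat T" and "atoms S \<subseteq> T"
  shows "S \<subseteq> T"
proof
  fix x assume "x \<in> S"
  then show "x \<in> T"
  proof (induction x rule: less_induct)
    case (less x)
    show ?case
    proof (cases "x = 0 \<or> x \<in> atoms S")
      case True
      then show ?thesis using assms by (auto simp: submonoid_nat_def)
    next
      case False
      then obtain y z where "y \<in> S - {0}" "z \<in> S - {0}" "x = y + z"
        using less.prems unfolding atoms_def by blast
      then show ?thesis
        using less.IH[of y] less.IH[of z] assms(1) by (auto simp: submonoid_nat_def)
    qed
  qed
qed

lemma generates_atoms:
  assumes "submonoid_nat S"
  shows "generates (atoms S) S"
  unfolding generates_def
proof
  show "submonoid_nat hull (atoms S) \<subseteq> S"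
    using atoms_subset assms by (rule hull_minimal)
  show "S \<subseteq> submonoid_nat hull (atoms S)"
    using submonoid_nat_hull hull_subset by (rule subset_if_atoms_subset)
qed

text \<open>A sum equal to \<open>a\<close> needs a zero summand, and then the other summand is
  \<open>a\<close> itself, which has been removed.\<close>

lemma submonoid_nat_remove_atom:
  assumes "submonoid_nat S" and "a \<in> atoms S"
  shows "submonoid_nat (S - {a})"
  using assms by (fastforce simp: submonoid_nat_def atoms_def)

text \<open>A subset of \<open>S\<close> that misses an atom \<open>a\<close> only generates inside
  the proper submonoid \<open>S - {a}\<close>.\<close>

lemma atoms_subset_generating_set:
  assumes "submonoid_nat S" and "generates B S"
  shows "atoms S \<subseteq> B"
proof
  fix a assume a: "a \<in> atoms S"
  show "a \<in> B"
  proof (rule ccontr)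
    assume "a \<notin> B"
    moreover have "B \<subseteq> S"
      using assms(2) hull_subset unfolding generates_def by metis
    ultimately have "submonoid_nat hull B \<subseteq> S - {a}"
      using submonoid_nat_remove_atom[OF assms(1) a] by (intro hull_minimal) auto
    then show False
      using a assms(2) atoms_subset unfolding generates_def by blast
  qed
qed

text \<open>The atoms generate \<open>S\<close> and lie in every generating set, so no other one can
  be minimal. This resolves the \<open>THE\<close> in \<open>embedding_dim\<close>.\<close>

lemma minimal_generating_set_iff:
  assumes "submonoid_nat S"
  shows "minimal_generating_set A S \<longleftrightarrow> A = atoms S"
  using generates_atoms[OF assms] atoms_subset_generating_set[OF assms]
  unfolding minimal_generating_set_def by blast

lemma embedding_dim_eq_card_atoms:
  assumes "submonoid_nat S"
  shows "embedding_dim S = card (atoms S)"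
  unfolding embedding_dim_def minimal_generating_set_iff[OF assms] by simp

text \<open>Distinct atoms are incongruent modulo any fixed nonzero element of \<open>S\<close>.\<close>

lemma finite_atoms:
  assumes "submonoid_nat S"
  shows "finite (atoms S)"
proof (cases "S \<subseteq> {0}")
  case True
  then show ?thesis
    by (metis atoms_subset finite.emptyI finite_insert finite_subset)
next
  case False
  then obtain m where m: "m \<in> S" "m > 0" by auto
  have less: False
    if "x \<in> atoms S" "y \<in> atoms S" "x < y" "x mod m = y mod m" for x y
  proof -
    have "m dvd y - x"
      using that mod_eq_dvd_iff_nat[of x y m] by simp
    then obtain k where "y - x = k * m" by (metis dvdE mult.commute)
    \<comment> \<open>Both \<open>x\<close> and \<open>k * m\<close> are nonzero elements of
      \<open>S\<close>, so this sum contradicts that \<open>y\<close> is an atom.\<close>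
    then have y: "y = x + k * m" "k * m \<noteq> 0" using that by linarith+
    then have "x \<in> S - {0}" "k * m \<in> S - {0}"
      using that submonoid_nat_mult[OF assms m(1), of k] by (auto simp: atoms_def)
    then show False
      using that(2) y(1) unfolding atoms_def mem_Collect_eq by metis
  qed
  have "inj_on (\<lambda>x. x mod m) (atoms S)"
    using less by (intro inj_onI) (metis linorder_neqE_nat)
  moreover have "(\<lambda>x. x mod m) ` atoms S \<subseteq> {..<m}"
    using m by auto
  ultimately show ?thesis
    by (meson finite_imageD finite_lessThan finite_subset)
qed

lemma cov_set_diff_family_min:
  assumes "covariety \<C>" and "S \<in> \<C>" and "A \<subseteq> S"
  shows "cov_set \<C> (A - family_min \<C>)"
proof -
  \<comment> \<open>A covariety is finite, so some maximal member lies above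
    \<open>S\<close>.\<close>
  obtain M where "M \<in> \<C>" "S \<subseteq> M" "\<forall>T\<in>\<C>. M \<subseteq> T \<longrightarrow> M = T"
    using finite_has_maximal2[OF finite_covariety[OF assms(1)] assms(2)] by blast
  then show ?thesis
    using assms(3) unfolding cov_set_def maximal_in_def by blast
qed

lemma cov_closure_atoms:
  assumes "covariety \<C>" and "S \<in> \<C>"
  shows "cov_closure \<C> (atoms S - family_min \<C>) = S"
proof -
  have "S \<subseteq> T" if T: "T \<in> \<C>" "atoms S - family_min \<C> \<subseteq> T" for T
  proof (rule subset_if_atoms_subset)
    show "submonoid_nat T"
      using T(1) assms(1) unfolding covariety_def numerical_semigroup_def by blast
    show "atoms S \<subseteq> T"
      using T family_min_least(2)[OF assms(1) T(1)] by blast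
  qed
  then show ?thesis
    unfolding cov_closure_def using assms(2) atoms_subset by blast
qed

theorem proposition6p1:
  fixes \<C> :: "nat set set" and S :: "nat set"
  assumes "covariety \<C>" and "S \<in> \<C>"
  shows "cov_rank \<C> S \<le> embedding_dim S"
proof -
  have S: "submonoid_nat S"
    using assms unfolding covariety_def numerical_semigroup_def by blast
  have "cov_rank \<C> S \<le> card (atoms S - family_min \<C>)"
    unfolding cov_rank_def
    using cov_set_diff_family_min[OF assms atoms_subset] cov_closure_atoms[OF assms]
    by (intro Least_le) blast
  \<comment> \<open>Finiteness of the atoms matters here, because \<open>card\<close> of an infinite
    set is 0.\<close>
  also have "\<dots> \<le> card (atoms S)"
    by (intro card_mono finite_atoms S) auto
  finally show ?thesis
    by (simp add: embedding_dim_eq_card_atoms[OF S])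
qed

end
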